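(* For $n\ge1$ let $Q_n=\{-1,1\}^n$ and let $V_n=\{{\bf u}\otimes{\bf u}:{\bf u}\in Q_n\}\cup\{{\bf 0}\}\subseteq\mathbb{R}^{n^2}$, equipped with the distance $d(x,y)=\|x-y\|^2$ (squared Euclidean distance). For every $\epsilon>0$ there is $n_0$ such that for all $n\ge n_0$, $c_1(V_n,d)\ge \frac87-\epsilon$.
   Context: ${\bf u}\otimes{\bf u}$ is the tensor product: the vector indexed by $(i,j)\in[n]^2$ with entry ${\bf u}_i{\bf u}_j$. For a finite set $X$ with distance $d$, $c_1(X,d)$ is the infimum of $D\ge1$ such that for some $M$, some $\phi:X\to\mathbb{R}^M$ and some $\gamma>0$, $\gamma\,d(a,b)\le\|\phi(a)-\phi(b)\|_1\le\gamma D\,d(a,b)$ for all $a,b\in X$. *)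

theory Defs
  imports "HOL-Analysis.Analysis"
begin

text \<open>
  The dimension varies inside the statement, so a vector with a finite index set \<open>I\<close> is a
  function in \<open>I \<rightarrow>\<^sub>E UNIV\<close>. This makes equality of vectors equality of functions.
\<close>

definition Q :: "nat \<Rightarrow> (nat \<Rightarrow> real) set" where
  "Q n = {1..n} \<rightarrow>\<^sub>E {-1, 1}"

definition tensor :: "nat \<Rightarrow> (nat \<Rightarrow> real) \<Rightarrow> (nat \<Rightarrow> real) \<Rightarrow> (nat \<times> nat \<Rightarrow> real)" where
  "tensor n u v = (\<lambda>(i, j)\<in>{1..n} \<times> {1..n}. u i * v j)"

definition V :: "nat \<Rightarrow> (nat \<times> nat \<Rightarrow> real) set" where
  "V n = {tensor n u u | u. u \<in> Q n} \<union> {\<lambda>p\<in>{1..n} \<times> {1..n}. 0}"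

definition sqdist :: "nat \<Rightarrow> (nat \<times> nat \<Rightarrow> real) \<Rightarrow> (nat \<times> nat \<Rightarrow> real) \<Rightarrow> real" where
  "sqdist n x y = (L2_set (\<lambda>p. x p - y p) ({1..n} \<times> {1..n}))\<^sup>2"

definition l1_dist :: "nat \<Rightarrow> (nat \<Rightarrow> real) \<Rightarrow> (nat \<Rightarrow> real) \<Rightarrow> real" where
  "l1_dist M x y = (\<Sum>i<M. \<bar>x i - y i\<bar>)"

text \<open>
  Only the first \<open>M\<close> coordinates of \<open>\<phi> a\<close> enter, so \<open>\<phi>\<close> is a map into \<open>M\<close>-dimensional
  \<open>\<ell>\<^sub>1\<close>.
\<close>

definition l1_distortions :: "'a set \<Rightarrow> ('a \<Rightarrow> 'a \<Rightarrow> real) \<Rightarrow> real set" where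
  "l1_distortions X d = {D. D \<ge> 1 \<and>
     (\<exists>(M::nat) (\<phi> :: 'a \<Rightarrow> nat \<Rightarrow> real) \<gamma>. \<gamma> > 0 \<and>
        (\<forall>a\<in>X. \<forall>b\<in>X. \<gamma> * d a b \<le> l1_dist M (\<phi> a) (\<phi> b) \<and>
                         l1_dist M (\<phi> a) (\<phi> b) \<le> \<gamma> * D * d a b))}"

definition c1 :: "'a set \<Rightarrow> ('a \<Rightarrow> 'a \<Rightarrow> real) \<Rightarrow> real" where
  "c1 X d = Inf (l1_distortions X d)"

text \<open>
  The infimum is over a nonempty set that is bounded below, so the unspecified value of
  \<^term>\<open>Inf {} :: real\<close> plays no role.
\<close>

lemma bdd_below_l1_distortions: "bdd_below (l1_distortions X d)"
  by (rule bdd_belowI[of _ 1]) (auto simp: l1_distortions_def)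

lemma l1_distortions_nonempty:
  assumes fin: "finite X"
    and zero: "\<And>a. a \<in> X \<Longrightarrow> d a a = 0"
    and pos: "\<And>a b. a \<in> X \<Longrightarrow> b \<in> X \<Longrightarrow> a \<noteq> b \<Longrightarrow> d a b > 0"
  shows "l1_distortions X d \<noteq> {}"
proof -
  obtain f :: "'a \<Rightarrow> nat" where f: "inj_on f X"
    using fin finite_imp_inj_to_nat_seg by blast
  define S where "S = (\<lambda>(a, b). \<bar>real (f a) - real (f b)\<bar> / d a b) ` (X \<times> X)"
  define T where "T = (\<lambda>(a, b). d a b / \<bar>real (f a) - real (f b)\<bar>) ` (X \<times> X)"
  define A where "A = Max (insert 1 S)"
  define B where "B = Max (insert 1 T)"
  have finS: "finite (insert 1 S)" and finT: "finite (insert 1 T)"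
    using fin by (auto simp: S_def T_def)
  have A1: "A \<ge> 1" and B1: "B \<ge> 1"
    unfolding A_def B_def using finS finT by (auto intro: Max_ge)
  have main: "1 / B * d a b \<le> \<bar>real (f a) - real (f b)\<bar> \<and>
      \<bar>real (f a) - real (f b)\<bar> \<le> 1 / B * (A * B) * d a b" if ab: "a \<in> X" "b \<in> X" for a b
  proof (cases "a = b")
    case True
    then show ?thesis using zero ab by simp
  next
    case False
    have dp: "d a b > 0" using pos ab False by blast
    have fp: "\<bar>real (f a) - real (f b)\<bar> > 0"
      using f ab False by (auto simp: inj_on_def)
    have "\<bar>real (f a) - real (f b)\<bar> / d a b \<in> S" "d a b / \<bar>real (f a) - real (f b)\<bar> \<in> T"
      using ab by (auto simp: S_def T_def)
    then have "\<bar>real (f a) - real (f b)\<bar> / d a b \<le> A" "d a b / \<bar>real (f a) - real (f b)\<bar> \<le> B"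
      unfolding A_def B_def using finS finT by (auto intro: Max_ge)
    then have "\<bar>real (f a) - real (f b)\<bar> \<le> A * d a b" "d a b \<le> B * \<bar>real (f a) - real (f b)\<bar>"
      using dp fp by (simp_all add: pos_divide_le_eq)
    moreover have "1 / B * (A * B) = A" "0 < B" using B1 by auto
    ultimately show ?thesis by (simp only: times_divide_eq_left mult_1 pos_divide_le_eq) (simp add: mult.commute)
  qed
  have "1 * 1 \<le> A * B" by (rule mult_mono) (use A1 B1 in auto)
  moreover have "1 / B > 0 \<and> (\<forall>a\<in>X. \<forall>b\<in>X.
      1 / B * d a b \<le> l1_dist 1 (\<lambda>_. real (f a)) (\<lambda>_. real (f b)) \<and>
      l1_dist 1 (\<lambda>_. real (f a)) (\<lambda>_. real (f b)) \<le> 1 / B * (A * B) * d a b)"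
  proof (intro conjI ballI)
    show "1 / B > 0" using B1 by simp
  next
    fix a b assume ab: "a \<in> X" "b \<in> X"
    have l1: "l1_dist 1 (\<lambda>_. real (f a)) (\<lambda>_. real (f b)) = \<bar>real (f a) - real (f b)\<bar>"
      by (simp add: l1_dist_def)
    show "1 / B * d a b \<le> l1_dist 1 (\<lambda>_. real (f a)) (\<lambda>_. real (f b))"
      unfolding l1 by (rule main[OF ab, THEN conjunct1])
    show "l1_dist 1 (\<lambda>_. real (f a)) (\<lambda>_. real (f b)) \<le> 1 / B * (A * B) * d a b"
      unfolding l1 by (rule main[OF ab, THEN conjunct2])
  qed
  then have "\<exists>(M::nat) (\<phi> :: 'a \<Rightarrow> nat \<Rightarrow> real) \<gamma>. \<gamma> > 0 \<and> (\<forall>a\<in>X. \<forall>b\<in>X.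
      \<gamma> * d a b \<le> l1_dist M (\<phi> a) (\<phi> b) \<and> l1_dist M (\<phi> a) (\<phi> b) \<le> \<gamma> * (A * B) * d a b)"
    by (rule_tac exI[of _ 1], rule_tac exI[of _ "\<lambda>a _. real (f a)"], rule_tac exI[of _ "1 / B"])
  ultimately have "A * B \<in> l1_distortions X d"
    by (simp only: l1_distortions_def mem_Collect_eq mult_1 simp_thms)
  then show ?thesis by blast
qed

lemma finite_V: "finite (V n)"
proof -
  have "V n = (\<lambda>u. tensor n u u) ` Q n \<union> {\<lambda>p\<in>{1..n} \<times> {1..n}. 0}"
    by (auto simp: V_def)
  moreover have "finite (Q n)"
    unfolding Q_def by (rule finite_PiE) simp_all
  ultimately show ?thesis by (simp only: finite_Un finite_imageI finite.emptyI finite_insert simp_thms)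
qed

lemma V_extensional: "V n \<subseteq> extensional ({1..n} \<times> {1..n})"
  by (auto simp: V_def tensor_def)

lemma l1_distortions_V_nonempty: "l1_distortions (V n) (sqdist n) \<noteq> {}"
proof (rule l1_distortions_nonempty[OF finite_V])
  fix x y assume xy: "x \<in> V n" "y \<in> V n" "x \<noteq> y"
  have "x \<in> extensional ({1..n} \<times> {1..n})" "y \<in> extensional ({1..n} \<times> {1..n})"
    using xy V_extensional[of n] by blast+
  then have "\<exists>p\<in>{1..n} \<times> {1..n}. x p \<noteq> y p"
    using xy(3) extensionalityI[of x "{1..n} \<times> {1..n}" y] by blast
  then have "L2_set (\<lambda>p. x p - y p) ({1..n} \<times> {1..n}) \<noteq> 0"
    by (subst L2_set_eq_0_iff) auto
  then show "sqdist n x y > 0" by (simp add: sqdist_def)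
qed (simp add: sqdist_def L2_set_def)

end

theory Submission
  imports Defs "HOL-Real_Asymp.Real_Asymp"
begin

text \<open>
  Every \<open>\<ell>\<^sub>1\<close> distance on a finite set is a nonnegative combination of cuts. A cut of \<open>V n\<close> amounts to
  an antipodally symmetric set \<open>S \<subseteq> Q n\<close>, the part separated from \<open>0\<close>. The bound comes from
  comparing, on cuts and on the given metric, the average over all pairs with a combination of the
  averages over cube edges and over pairs \<open>(u \<otimes> u, 0)\<close>. For cuts this comparison follows from an
  isoperimetric inequality: a set \<open>A\<close> of at most half of the vertices of the cube has at least
  \<open>|A| (n - log |A|) + p\<close> boundary edges, where \<open>p\<close> counts the points of \<open>A\<close> whose antipode is in \<open>A\<close>.
  For symmetric \<open>A\<close> of density \<open>\<sigma>\<close> this gives \<open>1 + log (1 / \<sigma>)\<close> boundary edges per vertex, and the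
  tangent to the logarithm at \<open>\<sigma> = 1/8\<close> yields the constant \<open>8/7\<close>.
\<close>

subsection \<open>Inequalities for \<open>t log t\<close>\<close>

text \<open>With base 2, \<open>xlog (2 ^ k) = k * 2 ^ k\<close> is the inner degree of a
  \<open>k\<close>-dimensional subcube, an equality case of edge isoperimetry.\<close>

definition xlog :: "real \<Rightarrow> real" where
  "xlog t = t * log 2 t"

lemma xlog_0 [simp]: "xlog 0 = 0" and xlog_1 [simp]: "xlog 1 = 0"
  by (simp_all add: xlog_def)

lemma xlog_half: "xlog (1/2) = -1/2"
  by (simp add: xlog_def log_divide)

lemma xlog_quarter: "xlog (1/4) = -1/2"
proof -
  have "log 2 (4::real) = log 2 (2 ^ 2)" by simp
  then have "log 2 (4::real) = 2" by (simp only: log_pow_cancel)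
  then show ?thesis by (simp add: xlog_def log_divide)
qed

lemma xlog_mult:
  assumes "a > 0" "t \<ge> 0"
  shows "xlog (a * t) = t * xlog a + a * xlog t"
  using assms by (cases "t = 0") (auto simp: xlog_def log_mult algebra_simps)

lemma has_real_derivative_xlog [derivative_intros]:
  assumes "(f has_real_derivative f') (at x)" "f x > 0"
  shows "((\<lambda>x. xlog (f x)) has_real_derivative (log 2 (f x) + 1 / ln 2) * f') (at x)"
  unfolding xlog_def using assms
  by (auto intro!: derivative_eq_intros simp: field_simps)

text \<open>Continuity at 0 matters because the concavity arguments below use intervals starting at
  0.\<close>

lemma continuous_on_xlog_atLeast: "continuous_on {0..} xlog"
proof (unfold continuous_on_def, intro ballI)
  fix x :: real assume x: "x \<in> {0..}"
  show "(xlog \<longlongrightarrow> xlog x) (at x within {0..})"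
  proof (cases "x = 0")
    case True
    have "((\<lambda>t::real. t * log 2 t) \<longlongrightarrow> 0) (at_right 0)"
      by real_asymp
    then show ?thesis using True by (simp add: at_within_Ici_at_right xlog_def [abs_def])
  next
    case False
    then have "(xlog has_real_derivative (log 2 x + 1 / ln 2) * 1) (at x)"
      using x by (intro derivative_intros has_real_derivative_xlog) auto
    then have "isCont xlog x" by (rule DERIV_isCont)
    then show ?thesis
      by (metis isContD tendsto_within_subset subset_UNIV)
  qed
qed

lemma continuous_on_xlog [continuous_intros]:
  "continuous_on A f \<Longrightarrow> (\<And>x. x \<in> A \<Longrightarrow> f x \<ge> 0) \<Longrightarrow> continuous_on A (\<lambda>x. xlog (f x))"
  by (rule continuous_on_compose2 [OF continuous_on_xlog_atLeast]) auto

text \<open>By the mean value theorem, a negative value between nonnegative ends forces a negative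
  slope before it and a positive one after it, so \<open>f''\<close> would be positive somewhere.
  Derivatives are asked only in the open interval, since \<open>xlog\<close> has none at 0.\<close>

lemma nonneg_between_if_second_deriv_nonpos:
  fixes f f' f'' :: "real \<Rightarrow> real"
  assumes cont: "continuous_on {a..b} f"
    and d1: "\<And>x. a < x \<Longrightarrow> x < b \<Longrightarrow> (f has_real_derivative f' x) (at x)"
    and d2: "\<And>x. a < x \<Longrightarrow> x < b \<Longrightarrow> (f' has_real_derivative f'' x) (at x)"
    and le: "\<And>x. a < x \<Longrightarrow> x < b \<Longrightarrow> f'' x \<le> 0"
    and ends: "f a \<ge> 0" "f b \<ge> 0"
    and x: "a \<le> x" "x \<le> b"
  shows "f x \<ge> 0"
proof (rule ccontr)
  assume neg: "\<not> f x \<ge> 0"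
  then have ax: "a < x" and xb: "x < b"
    using ends x by (metis order_le_less)+
  have "\<exists>l z. a < z \<and> z < x \<and> DERIV f z :> l \<and> f x - f a = (x - a) * l"
    using ax xb d1 by (intro MVT continuous_on_subset [OF cont])
      (auto simp: real_differentiable_def intro: less_trans)
  then obtain y where y: "a < y" "y < x" "f x - f a = (x - a) * f' y"
    using d1 xb DERIV_unique by (metis less_trans)
  have "\<exists>l z. x < z \<and> z < b \<and> DERIV f z :> l \<and> f b - f x = (b - x) * l"
    using ax xb d1 by (intro MVT continuous_on_subset [OF cont])
      (auto simp: real_differentiable_def intro: less_trans)
  then obtain z where z: "x < z" "z < b" "f b - f x = (b - x) * f' z"
    using d1 ax DERIV_unique by (metis less_trans)
  have "(x - a) * f' y < 0" "(b - x) * f' z > 0"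
    using y(3) z(3) neg ends by linarith+
  then have sgn: "f' y < 0" "f' z > 0"
    using ax xb by (auto simp: mult_less_0_iff zero_less_mult_iff)
  have yz: "y < z" using y z by linarith
  have "\<exists>w. y < w \<and> w < z \<and> f' z - f' y = (z - y) * f'' w"
    using yz y z d2 by (intro MVT2) auto
  then obtain w where w: "y < w" "w < z" "f' z - f' y = (z - y) * f'' w" by blast
  have "(z - y) * f'' w \<le> 0"
    using le [of w] w y z by (intro mult_nonneg_nonpos) auto
  then show False using w(3) sgn by linarith
qed

text \<open>The difference of the two sides is concave in \<open>t\<close>, its second derivative
  being a multiple of \<open>1 / (\<alpha> + t) - 1 / t\<close>. Inequalities of this shape
  therefore need checking only at the ends of an interval.\<close>

lemma xlog_diff_nonneg_between:
  assumes "\<alpha> \<ge> 0" "0 \<le> r" "r \<le> t" "t \<le> s"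
    and "xlog r + p * r + q \<le> xlog (\<alpha> + r)"
    and "xlog s + p * s + q \<le> xlog (\<alpha> + s)"
  shows "xlog t + p * t + q \<le> xlog (\<alpha> + t)"
proof -
  have "0 \<le> xlog (\<alpha> + t) - xlog t - p * t - q"
  proof (rule nonneg_between_if_second_deriv_nonpos [where a = r and b = s and
        f = "\<lambda>t. xlog (\<alpha> + t) - xlog t - p * t - q" and
        f' = "\<lambda>t. log 2 (\<alpha> + t) - log 2 t - p" and
        f'' = "\<lambda>t. (1 / (\<alpha> + t) - 1 / t) / ln 2"])
    show "continuous_on {r..s} (\<lambda>t. xlog (\<alpha> + t) - xlog t - p * t - q)"
      using assms by (intro continuous_intros) auto
  next
    fix x assume x: "r < x" "x < s"
    show "((\<lambda>t. xlog (\<alpha> + t) - xlog t - p * t - q) has_real_derivative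
        log 2 (\<alpha> + x) - log 2 x - p) (at x)"
      using assms x by (auto intro!: derivative_eq_intros)
    show "((\<lambda>t. log 2 (\<alpha> + t) - log 2 t - p) has_real_derivative
        (1 / (\<alpha> + x) - 1 / x) / ln 2) (at x)"
      using assms x by (auto intro!: derivative_eq_intros simp: diff_divide_distrib mult.commute)
    have "1 / (\<alpha> + x) \<le> 1 / x" using assms x by (intro divide_left_mono) auto
    then show "(1 / (\<alpha> + x) - 1 / x) / ln 2 \<le> 0"
      by (simp add: divide_le_0_iff)
  qed (use assms in auto)
  then show ?thesis by simp
qed

text \<open>Both ends \<open>b = 0\<close> and \<open>b = a\<close> give equality, and concavity in
  \<open>b\<close> does the rest. In the induction on the dimension, \<open>a\<close> and
  \<open>b\<close> are the sizes of two slices, which share at most \<open>b\<close> points.\<close>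

lemma xlog_add_ge:
  assumes "0 \<le> b" "b \<le> a"
  shows "xlog a + xlog b + 2 * b \<le> xlog (a + b)"
proof -
  have "xlog a + xlog a + 2 * a = xlog (a + a)"
    using xlog_mult [of 2 a] assms by (simp add: xlog_def algebra_simps)
  then show ?thesis
    using xlog_diff_nonneg_between [of a 0 b a 2 "xlog a"] assms by simp
qed

text \<open>Equality holds at 0 and 1/2, with a concave difference in between. This is the end
  \<open>\<beta> = 0\<close> of the complement inequality.\<close>

lemma xlog_le_xlog_one_minus:
  assumes "0 \<le> \<gamma>" "\<gamma> \<le> 1/2"
  shows "xlog \<gamma> \<le> xlog (1 - \<gamma>)"
proof -
  have "0 \<le> xlog (1 - \<gamma>) - xlog \<gamma>"
  proof (rule nonneg_between_if_second_deriv_nonpos [where a = 0 and b = "1/2" and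
        f = "\<lambda>t. xlog (1 - t) - xlog t" and
        f' = "\<lambda>t. - log 2 (1 - t) - log 2 t - 2 / ln 2" and
        f'' = "\<lambda>t. (1 / (1 - t) - 1 / t) / ln 2"])
    show "continuous_on {0..1/2} (\<lambda>t. xlog (1 - t) - xlog t)"
      by (intro continuous_intros) auto
  next
    fix x :: real assume x: "0 < x" "x < 1/2"
    show "((\<lambda>t. xlog (1 - t) - xlog t) has_real_derivative
        - log 2 (1 - x) - log 2 x - 2 / ln 2) (at x)"
      using x by (auto intro!: derivative_eq_intros)
    show "((\<lambda>t. - log 2 (1 - t) - log 2 t - 2 / ln 2) has_real_derivative
        (1 / (1 - x) - 1 / x) / ln 2) (at x)"
      using x by (auto intro!: derivative_eq_intros simp: field_simps)
    have "1 / (1 - x) \<le> 1 / x" using x by (intro divide_left_mono) auto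
    then show "(1 / (1 - x) - 1 / x) / ln 2 \<le> 0"
      by (simp add: divide_le_0_iff)
  qed (use assms in auto)
  then show ?thesis by simp
qed

text \<open>\<open>xlog\<close> is convex and equals -1/2 at both 1/4 and 1/2. This settles the end
  \<open>\<beta> = \<gamma>\<close> of the complement inequality for such
  \<open>\<gamma>\<close>.\<close>

lemma xlog_le_neg_half:
  assumes "1/4 \<le> \<gamma>" "\<gamma> \<le> 1/2"
  shows "xlog \<gamma> \<le> -1/2"
proof -
  have "0 \<le> - xlog \<gamma> - 1/2"
  proof (rule nonneg_between_if_second_deriv_nonpos [where a = "1/4" and b = "1/2" and
        f = "\<lambda>t. - xlog t - 1/2" and
        f' = "\<lambda>t. - log 2 t - 1 / ln 2" and
        f'' = "\<lambda>t. - 1 / t / ln 2"])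
    show "continuous_on {1/4..1/2} (\<lambda>t. - xlog t - 1/2)"
      by (intro continuous_intros) auto
  next
    fix x :: real assume x: "1/4 < x" "x < 1/2"
    show "((\<lambda>t. - xlog t - 1/2) has_real_derivative - log 2 x - 1 / ln 2) (at x)"
      using x by (auto intro!: derivative_eq_intros)
    show "((\<lambda>t. - log 2 t - 1 / ln 2) has_real_derivative - 1 / x / ln 2) (at x)"
      using x by (auto intro!: derivative_eq_intros simp: field_simps)
    show "- 1 / x / ln 2 \<le> 0"
      using x by simp
  qed (use assms in \<open>auto simp: xlog_half xlog_quarter\<close>)
  then show ?thesis by simp
qed

text \<open>This is the complement inequality at \<open>\<beta> = 1/2 - \<gamma>\<close>, where the
  two branches of its minimum meet. Both ends of the range of \<open>\<gamma>\<close> are equality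
  cases.\<close>

lemma xlog_crossover:
  assumes "1/4 \<le> \<gamma>" "\<gamma> \<le> 1/2"
  shows "xlog \<gamma> + xlog (1/2 - \<gamma>) + 2 - 4 * \<gamma> \<le> xlog (3/2 - 2 * \<gamma>)"
proof -
  have "0 \<le> xlog (3/2 - 2 * \<gamma>) - xlog \<gamma> - xlog (1/2 - \<gamma>) - 2 + 4 * \<gamma>"
  proof (rule nonneg_between_if_second_deriv_nonpos [where a = "1/4" and b = "1/2" and
        f = "\<lambda>t. xlog (3/2 - 2 * t) - xlog t - xlog (1/2 - t) - 2 + 4 * t" and
        f' = "\<lambda>t. - 2 * log 2 (3/2 - 2 * t) - log 2 t + log 2 (1/2 - t) + 4 - 2 / ln 2" and
        f'' = "\<lambda>t. (4 / (3/2 - 2 * t) - 1 / t - 1 / (1/2 - t)) / ln 2"])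
    show "continuous_on {1/4..1/2} (\<lambda>t. xlog (3/2 - 2 * t) - xlog t - xlog (1/2 - t) - 2 + 4 * t)"
      by (intro continuous_intros) auto
  next
    fix x :: real assume x: "1/4 < x" "x < 1/2"
    show "((\<lambda>t. xlog (3/2 - 2 * t) - xlog t - xlog (1/2 - t) - 2 + 4 * t) has_real_derivative
        - 2 * log 2 (3/2 - 2 * x) - log 2 x + log 2 (1/2 - x) + 4 - 2 / ln 2) (at x)"
      using x by (auto intro!: derivative_eq_intros simp: field_simps)
    show "((\<lambda>t. - 2 * log 2 (3/2 - 2 * t) - log 2 t + log 2 (1/2 - t) + 4 - 2 / ln 2)
        has_real_derivative (4 / (3/2 - 2 * x) - 1 / x - 1 / (1/2 - x)) / ln 2) (at x)"
      using x by (auto intro!: derivative_eq_intros simp: divide_simps)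
    \<comment> \<open>The first term is at most 8 because \<open>x < 1/2\<close>; the other two add
      up to at least 8 because \<open>x * (1/2 - x)\<close> peaks at 1/16.\<close>
    have "4 / (3/2 - 2 * x) \<le> 4 / (1/2)" using x by (intro divide_left_mono) auto
    moreover have "8 \<le> 1 / x + 1 / (1/2 - x)"
    proof -
      have "x * (1/2 - x) \<le> 1/16"
        using zero_le_power2 [of "x - 1/4"] by (simp add: power2_eq_square algebra_simps)
      moreover have "0 < x * (1/2 - x)" using x by simp
      ultimately have "(1/2) / (1/16) \<le> (1/2) / (x * (1/2 - x))"
        by (intro divide_left_mono) auto
      also have "\<dots> = 1 / x + 1 / (1/2 - x)" using x by (simp add: field_simps)
      finally show ?thesis by simp
    qed
    ultimately show "(4 / (3/2 - 2 * x) - 1 / x - 1 / (1/2 - x)) / ln 2 \<le> 0"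
      by (simp add: divide_le_0_iff)
  qed (use assms in \<open>auto simp: xlog_half xlog_quarter\<close>)
  then show ?thesis by simp
qed

text \<open>Concavity in \<open>\<beta>\<close> reduces each range to its ends. Up to
  \<open>\<gamma> = 1/4\<close> the branch \<open>2 * \<beta>\<close> works throughout; beyond that
  the range is split where the branches meet.\<close>

lemma xlog_complement_ineq:
  assumes "0 \<le> \<beta>" "\<beta> \<le> \<gamma>" "\<gamma> \<le> 1/2"
  shows "xlog \<gamma> + xlog \<beta> + 2 * \<beta> + min (2 * \<beta>) (1 - 2 * \<gamma>) \<le> xlog (1 - \<gamma> + \<beta>)"
proof (cases "\<gamma> \<le> 1/4")
  case True
  have end0: "xlog 0 + 4 * 0 + xlog \<gamma> \<le> xlog (1 - \<gamma> + 0)"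
    using xlog_le_xlog_one_minus [of \<gamma>] assms by simp
  \<comment> \<open>The end \<open>\<beta> = \<gamma>\<close> asks for
    \<open>2 * xlog \<gamma> + 4 * \<gamma> \<le> 0\<close>.\<close>
  have "xlog \<gamma> \<le> - 2 * \<gamma>"
  proof (cases "\<gamma> = 0")
    case False
    then have "log 2 \<gamma> \<le> log 2 (2 powr (-2))"
      using True assms by (simp add: powr_minus_divide)
    then have "log 2 \<gamma> \<le> -2" by (simp only: log_powr_cancel)
    then show ?thesis using mult_left_mono [of "log 2 \<gamma>" "-2" \<gamma>] assms
      by (simp add: xlog_def)
  qed simp
  then have "xlog \<gamma> + 4 * \<gamma> + xlog \<gamma> \<le> xlog (1 - \<gamma> + \<gamma>)" by simp
  then have "xlog \<beta> + 4 * \<beta> + xlog \<gamma> \<le> xlog (1 - \<gamma> + \<beta>)"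
    using xlog_diff_nonneg_between [OF _ _ _ _ end0] assms by simp
  then show ?thesis by (simp add: min_def)
next
  case False
  then have g: "1/4 \<le> \<gamma>" by simp
  have cross: "xlog \<gamma> + xlog (1/2 - \<gamma>) + 2 - 4 * \<gamma> \<le> xlog (1 - \<gamma> + (1/2 - \<gamma>))"
    using xlog_crossover [OF g assms(3)] by (simp add: algebra_simps)
  show ?thesis
  proof (cases "\<beta> \<le> 1/2 - \<gamma>")
    case True
    have "xlog \<beta> + 4 * \<beta> + xlog \<gamma> \<le> xlog (1 - \<gamma> + \<beta>)"
      using xlog_diff_nonneg_between [of "1 - \<gamma>" 0 \<beta> "1/2 - \<gamma>" 4 "xlog \<gamma>"]
        xlog_le_xlog_one_minus [of \<gamma>] assms cross True by simp
    then show ?thesis by (simp add: min_def)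
  next
    case False
    have "xlog \<beta> + 2 * \<beta> + (xlog \<gamma> + 1 - 2 * \<gamma>) \<le> xlog (1 - \<gamma> + \<beta>)"
      using xlog_diff_nonneg_between [of "1 - \<gamma>" "1/2 - \<gamma>" \<beta> \<gamma> 2 "xlog \<gamma> + 1 - 2 * \<gamma>"]
        xlog_le_neg_half [OF g assms(3)] assms cross False by simp
    then show ?thesis by (simp add: min_def)
  qed
qed

text \<open>
  Here \<open>N - c\<close> and \<open>b\<close> are the sizes of the two halves of a set in which one half fills most of its
  subcube, so that the isoperimetric inequality applies only to the complement of that half. The
  two branches of the minimum are the estimates without and with the antipodal terms.
\<close>

lemma xlog_complement_ineq_scaled:
  fixes b c N :: real
  assumes "N = 2 ^ n" "0 \<le> b" "b \<le> c" "2 * c \<le> N"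
  shows "n * (N - 2 * c) + xlog c + xlog b + 2 * b + min (2 * b) (N - 2 * c) \<le> xlog (N - c + b)"
proof -
  have N: "N > 0" "xlog N = n * N" using assms by (simp_all add: xlog_def)
  have *: "xlog (N * t) = n * N * t + N * xlog t" if "t \<ge> 0" for t
    using xlog_mult [OF N(1) that] N(2) by simp
  define \<beta> \<gamma> where "\<beta> = b / N" and "\<gamma> = c / N"
  have eq: "b = N * \<beta>" "c = N * \<gamma>" using N by (simp_all add: \<beta>_def \<gamma>_def)
  have r: "0 \<le> \<beta>" "\<beta> \<le> \<gamma>" "\<gamma> \<le> 1/2"
    using assms N by (auto simp: \<beta>_def \<gamma>_def divide_right_mono field_simps)
  have "N - c + b = N * (1 - \<gamma> + \<beta>)" by (simp add: eq algebra_simps)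
  then have 1: "xlog (N - c + b) = n * N * (1 - \<gamma> + \<beta>) + N * xlog (1 - \<gamma> + \<beta>)"
    using * r by simp
  have 2: "xlog c = n * N * \<gamma> + N * xlog \<gamma>" "xlog b = n * N * \<beta> + N * xlog \<beta>"
    unfolding eq using * r by simp_all
  have 3: "min (2 * b) (N - 2 * c) = N * min (2 * \<beta>) (1 - 2 * \<gamma>)"
    using N by (simp add: eq min_mult_distrib_left algebra_simps)
  show ?thesis
    using mult_left_mono [OF xlog_complement_ineq [OF r], of N] N
    unfolding 1 2 3 by (simp add: eq algebra_simps)
qed

subsection \<open>Edge isoperimetry with antipodes\<close>

definition flip :: "nat \<Rightarrow> (nat \<Rightarrow> real) \<Rightarrow> (nat \<Rightarrow> real)" where
  "flip i x = x(i := - x i)"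

definition antipode :: "nat \<Rightarrow> (nat \<Rightarrow> real) \<Rightarrow> (nat \<Rightarrow> real)" where
  "antipode n x = (\<lambda>i\<in>{1..n}. - x i)"

text \<open>Every edge inside \<open>A\<close> is counted from both ends, so for
  \<open>A \<subseteq> Q n\<close> the edge boundary has
  \<open>n * card A - inner_degree n A\<close> edges.\<close>

definition inner_degree :: "nat \<Rightarrow> (nat \<Rightarrow> real) set \<Rightarrow> nat" where
  "inner_degree n A = (\<Sum>i=1..n. card {x \<in> A. flip i x \<in> A})"

definition antipodal_count :: "nat \<Rightarrow> (nat \<Rightarrow> real) set \<Rightarrow> nat" where
  "antipodal_count n A = card {x \<in> A. antipode n x \<in> A}"

text \<open>For \<open>c = 1\<close> and \<open>c = -1\<close> these are the parts of
  \<open>A\<close> in two opposite facets, projected to \<open>Q n\<close> for induction on the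
  dimension.\<close>

definition slice :: "nat \<Rightarrow> real \<Rightarrow> (nat \<Rightarrow> real) set \<Rightarrow> (nat \<Rightarrow> real) set" where
  "slice n c A = {x \<in> Q n. x(Suc n := c) \<in> A}"

lemma finite_Q [simp]: "finite (Q n)"
  unfolding Q_def by (rule finite_PiE) simp_all

lemma card_Q: "card (Q n) = 2 ^ n"
  unfolding Q_def by (subst card_PiE) (simp_all add: card_insert_if numeral_2_eq_2)

lemma Q_values: "x \<in> Q n \<Longrightarrow> i \<in> {1..n} \<Longrightarrow> x i = 1 \<or> x i = -1"
  by (auto simp: Q_def PiE_iff)

lemma flip_in_Q: "x \<in> Q n \<Longrightarrow> i \<in> {1..n} \<Longrightarrow> flip i x \<in> Q n"
  unfolding Q_def flip_def PiE_iff extensional_def by auto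

lemma flip_flip [simp]: "flip i (flip i x) = x"
  by (auto simp: flip_def)

lemma antipode_in_Q: "x \<in> Q n \<Longrightarrow> antipode n x \<in> Q n"
  unfolding Q_def antipode_def PiE_iff by auto

lemma antipode_antipode: "x \<in> Q n \<Longrightarrow> antipode n (antipode n x) = x"
  by (auto simp: Q_def antipode_def PiE_iff extensional_def fun_eq_iff)

lemma bij_betw_flip: "i \<in> {1..n} \<Longrightarrow> bij_betw (flip i) (Q n) (Q n)"
  by (rule bij_betwI [of _ _ _ "flip i"]) (auto simp: flip_in_Q)

lemma Q_Suc: "Q (Suc n) = (\<lambda>x. x(Suc n := 1)) ` Q n \<union> (\<lambda>x. x(Suc n := -1)) ` Q n"
proof -
  have "{1..Suc n} = insert (Suc n) {1..n}" by auto
  then have "Q (Suc n) = (\<lambda>(y, g). g(Suc n := y)) ` ({-1, 1} \<times> Q n)"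
    by (simp only: Q_def PiE_insert_eq)
  also have "{-1, 1 :: real} \<times> Q n = Pair 1 ` Q n \<union> Pair (-1) ` Q n" by blast
  finally show ?thesis by (simp add: image_Un image_image fun_upd_def)
qed

text \<open>Points of \<open>Q n\<close> are \<open>undefined\<close> at \<open>Suc n\<close>, so
  overwriting that coordinate loses no information.\<close>

lemma inj_on_upd_Q: "inj_on (\<lambda>x. x(Suc n := c)) (Q n)"
proof (rule inj_onI)
  fix x y assume xy: "x \<in> Q n" "y \<in> Q n" "x(Suc n := c) = y(Suc n := c)"
  have *: "z (Suc n) = undefined" if "z \<in> Q n" for z
    using PiE_arb [OF that [unfolded Q_def], of "Suc n"] by simp
  have "x (Suc n) = y (Suc n)" using * [OF xy(1)] * [OF xy(2)] by simp
  then show "x = y" using xy(3) by (metis fun_upd_triv fun_upd_upd)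
qed

lemma card_Q_Suc:
  "card {x \<in> Q (Suc n). P x} =
    card {x \<in> Q n. P (x(Suc n := 1))} + card {x \<in> Q n. P (x(Suc n := -1))}"
proof -
  have "{x \<in> Q (Suc n). P x} =
      (\<lambda>x. x(Suc n := 1)) ` {x \<in> Q n. P (x(Suc n := 1))} \<union>
      (\<lambda>x. x(Suc n := -1)) ` {x \<in> Q n. P (x(Suc n := -1))}"
    by (auto simp: Q_Suc)
  moreover have "(\<lambda>x. x(Suc n := 1)) ` {x \<in> Q n. P (x(Suc n := 1))} \<inter>
      (\<lambda>x. x(Suc n := -1)) ` {x \<in> Q n. P (x(Suc n := -1))} = {}"
    by (auto dest!: fun_cong [of _ _ "Suc n"])
  moreover have "inj_on (\<lambda>x. x(Suc n := c)) {x \<in> Q n. R x}" for c R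
    by (rule inj_on_subset [OF inj_on_upd_Q]) auto
  ultimately show ?thesis
    by (simp add: card_Un_disjoint card_image)
qed

lemma slice_subset: "slice n c A \<subseteq> Q n"
  by (auto simp: slice_def)

lemma card_slices:
  assumes "A \<subseteq> Q (Suc n)"
  shows "card A = card (slice n 1 A) + card (slice n (-1) A)"
proof -
  have "A = {x \<in> Q (Suc n). x \<in> A}" using assms by auto
  then show ?thesis using card_Q_Suc [of n "\<lambda>x. x \<in> A"] by (simp add: slice_def)
qed

lemma card_Collect_restrict:
  assumes "A \<subseteq> Q n"
  shows "card {x \<in> A. P x} = card {x \<in> Q n. x \<in> A \<and> P x}"
  by (rule arg_cong [where f = card]) (use assms in auto)

text \<open>Flips in directions up to \<open>n\<close> stay within a slice; direction
  \<open>Suc n\<close> joins equal points of the two slices, counted from both ends.\<close>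

lemma inner_degree_Suc:
  assumes "A \<subseteq> Q (Suc n)"
  shows "inner_degree (Suc n) A = inner_degree n (slice n 1 A) + inner_degree n (slice n (-1) A)
    + 2 * card (slice n 1 A \<inter> slice n (-1) A)"
proof -
  have "card {x \<in> A. flip i x \<in> A} = card {x \<in> slice n 1 A. flip i x \<in> slice n 1 A}
      + card {x \<in> slice n (-1) A. flip i x \<in> slice n (-1) A}" if i: "i \<in> {1..n}" for i
  proof -
    have "flip i (x(Suc n := c)) = (flip i x)(Suc n := c)" for x c
      using i by (auto simp: flip_def)
    moreover have "{x \<in> Q n. x(Suc n := c) \<in> A \<and> (flip i x)(Suc n := c) \<in> A} =
        {x \<in> slice n c A. flip i x \<in> slice n c A}" for c
      using i by (auto simp: slice_def flip_in_Q)
    ultimately show ?thesis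
      by (simp add: card_Collect_restrict [OF assms] card_Q_Suc)
  qed
  moreover have "card {x \<in> A. flip (Suc n) x \<in> A} = 2 * card (slice n 1 A \<inter> slice n (-1) A)"
  proof -
    have "flip (Suc n) (x(Suc n := c)) = x(Suc n := - c)" for x c
      by (auto simp: flip_def)
    moreover have "{x \<in> Q n. x(Suc n := 1) \<in> A \<and> x(Suc n := -1) \<in> A} =
        slice n 1 A \<inter> slice n (-1) A" "{x \<in> Q n. x(Suc n := -1) \<in> A \<and> x(Suc n := 1) \<in> A} =
        slice n 1 A \<inter> slice n (-1) A"
      by (auto simp: slice_def)
    ultimately show ?thesis
      by (simp add: card_Collect_restrict [OF assms] card_Q_Suc)
  qed
  ultimately show ?thesis
    by (simp add: inner_degree_def sum.distrib)
qed

lemma card_antipode_swap: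
  assumes "A \<subseteq> Q n" "B \<subseteq> Q n"
  shows "card {x \<in> A. antipode n x \<in> B} = card {x \<in> B. antipode n x \<in> A}"
proof (rule bij_betw_same_card)
  show "bij_betw (antipode n) {x \<in> A. antipode n x \<in> B} {x \<in> B. antipode n x \<in> A}"
    using assms by (intro bij_betwI [of _ _ _ "antipode n"]) (auto simp: antipode_antipode subset_iff)
qed

text \<open>The antipode negates the last coordinate, so antipodal pairs always run between the
  slices.\<close>

lemma antipodal_count_Suc:
  assumes "A \<subseteq> Q (Suc n)"
  shows "antipodal_count (Suc n) A =
    2 * card {x \<in> slice n (-1) A. antipode n x \<in> slice n 1 A}"
proof -
  have "antipode (Suc n) (x(Suc n := c)) = (antipode n x)(Suc n := - c)" for x c
    by (auto simp: antipode_def fun_eq_iff)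
  moreover have "{x \<in> Q n. x(Suc n := c) \<in> A \<and> (antipode n x)(Suc n := d) \<in> A} =
      {x \<in> slice n c A. antipode n x \<in> slice n d A}" for c d
    by (auto simp: slice_def antipode_in_Q)
  ultimately have "antipodal_count (Suc n) A =
      card {x \<in> slice n 1 A. antipode n x \<in> slice n (-1) A} +
      card {x \<in> slice n (-1) A. antipode n x \<in> slice n 1 A}"
    by (simp add: antipodal_count_def card_Collect_restrict [OF assms] card_Q_Suc)
  then show ?thesis
    using card_antipode_swap [OF slice_subset slice_subset, of n 1 A "-1" A] by simp
qed

text \<open>Both sides are \<open>card U\<close> minus the number of points of \<open>B\<close> sent
  outside \<open>B\<close>, which \<open>\<sigma>\<close> matches with the points of
  \<open>U - B\<close> sent into \<open>B\<close>. It serves coordinate flips and the antipode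
  alike.\<close>

lemma card_involution_Diff:
  assumes fin: "finite U" and B: "B \<subseteq> U"
    and inv: "\<And>x. x \<in> U \<Longrightarrow> \<sigma> x \<in> U" "\<And>x. x \<in> U \<Longrightarrow> \<sigma> (\<sigma> x) = x"
  shows "card {x \<in> B. \<sigma> x \<in> B} + card (U - B) = card {x \<in> U - B. \<sigma> x \<in> U - B} + card B"
proof -
  have "card {x \<in> B. \<sigma> x \<notin> B} = card {x \<in> U - B. \<sigma> x \<in> B}"
  proof (rule bij_betw_same_card)
    show "bij_betw \<sigma> {x \<in> B. \<sigma> x \<notin> B} {x \<in> U - B. \<sigma> x \<in> B}"
      using inv B by (intro bij_betwI [of _ _ _ \<sigma>]) (auto simp: subset_iff)
  qed
  moreover have "card B = card {x \<in> B. \<sigma> x \<in> B} + card {x \<in> B. \<sigma> x \<notin> B}"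
    using fin B by (subst card_Un_disjoint [symmetric])
      (auto intro: finite_subset arg_cong [where f = card])
  moreover have "card (U - B) = card {x \<in> U - B. \<sigma> x \<in> U - B} + card {x \<in> U - B. \<sigma> x \<in> B}"
    using fin inv by (subst card_Un_disjoint [symmetric])
      (auto intro: arg_cong [where f = card])
  ultimately show ?thesis by simp
qed

lemma inner_degree_Diff:
  assumes "A \<subseteq> Q n"
  shows "inner_degree n A + n * card (Q n - A) = inner_degree n (Q n - A) + n * card A"
proof -
  have "(\<Sum>i=1..n. card {x \<in> A. flip i x \<in> A} + card (Q n - A)) =
      (\<Sum>i=1..n. card {x \<in> Q n - A. flip i x \<in> Q n - A} + card A)"
    by (intro sum.cong refl card_involution_Diff assms) (auto simp: flip_in_Q)
  then show ?thesis by (simp add: inner_degree_def sum.distrib)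
qed

lemma antipodal_count_Diff:
  assumes "A \<subseteq> Q n"
  shows "antipodal_count n A + card (Q n - A) = antipodal_count n (Q n - A) + card A"
  unfolding antipodal_count_def
  by (intro card_involution_Diff assms) (auto simp: antipode_in_Q antipode_antipode)

text \<open>Classical edge isoperimetry, valid for sets of every size. Induction handles the slices,
  and their intersection is at most the smaller one.\<close>

lemma inner_degree_le:
  assumes "A \<subseteq> Q n"
  shows "real (inner_degree n A) \<le> xlog (card A)"
  using assms
proof (induction n arbitrary: A)
  case 0
  then have "card A \<le> 1" using card_mono [OF finite_Q, of A 0] by (simp add: card_Q)
  then have "card A = 0 \<or> card A = 1" by linarith
  then show ?case by (auto simp: inner_degree_def)
next
  case (Suc n)
  define B C where "B = slice n 1 A" and "C = slice n (-1) A"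
  have fin: "finite B" "finite C"
    unfolding B_def C_def by (auto intro: finite_subset [OF slice_subset])
  have "inner_degree n B \<le> xlog (card B)" "inner_degree n C \<le> xlog (card C)"
    unfolding B_def C_def by (intro Suc.IH slice_subset)+
  moreover have "inner_degree (Suc n) A = inner_degree n B + inner_degree n C + 2 * card (B \<inter> C)"
    unfolding B_def C_def by (rule inner_degree_Suc [OF Suc.prems])
  moreover have "card A = card B + card C"
    unfolding B_def C_def by (rule card_slices [OF Suc.prems])
  moreover have "card (B \<inter> C) \<le> card B" "card (B \<inter> C) \<le> card C"
    using fin by (auto intro: card_mono)
  ultimately show ?case
    using xlog_add_ge [of "card B" "card C"] xlog_add_ge [of "card C" "card B"]
    by (cases "card B \<le> card C") (auto simp: add.commute)
qed

text \<open>Let \<open>X\<close> be the set on the left and \<open>Y\<close> its antipodal image.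
  Their union is counted by the antipodal count of \<open>A\<close>, their intersection by that of
  \<open>B\<close>.\<close>

lemma card_antipodal_overlap_le:
  assumes "A \<subseteq> Q n" "B \<subseteq> Q n"
  shows "2 * card {x \<in> B. x \<in> A \<and> antipode n x \<in> A} \<le> antipodal_count n A + antipodal_count n B"
proof -
  define X where "X = {x \<in> B. x \<in> A \<and> antipode n x \<in> A}"
  define Y where "Y = {x \<in> A. antipode n x \<in> A \<and> antipode n x \<in> B}"
  have fin: "finite A" "finite B" using assms finite_Q by (auto intro: finite_subset)
  have "bij_betw (antipode n) X Y"
    unfolding X_def Y_def using assms
    by (intro bij_betwI [of _ _ _ "antipode n"]) (auto simp: antipode_antipode subset_iff)
  then have "card X = card Y" by (rule bij_betw_same_card)
  moreover have "card X + card Y = card (X \<union> Y) + card (X \<inter> Y)"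
    using fin by (intro card_Un_Int) (auto simp: X_def Y_def)
  moreover have "card (X \<union> Y) \<le> antipodal_count n A" "card (X \<inter> Y) \<le> antipodal_count n B"
    unfolding antipodal_count_def using fin by (auto intro!: card_mono simp: X_def Y_def)
  ultimately show ?thesis unfolding X_def by linarith
qed

text \<open>\<open>A\<close> and \<open>B\<close> are the slices of a set of at most half the cube.
  If \<open>A\<close> exceeds half of its subcube, the induction hypothesis is applied to its
  complement, which is still at least as large as \<open>B\<close>.\<close>

lemma isoperimetric_step:
  assumes IH: "\<And>B. B \<subseteq> Q n \<Longrightarrow> 2 * card B \<le> 2 ^ n \<Longrightarrow>
      real (inner_degree n B + antipodal_count n B) \<le> xlog (card B)"
    and A: "A \<subseteq> Q n" and B: "B \<subseteq> Q n"
    and le: "card B \<le> card A" and sum: "card A + card B \<le> 2 ^ n"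
  shows "real (inner_degree n A + inner_degree n B + 2 * card (A \<inter> B)
      + 2 * card {x \<in> B. antipode n x \<in> A}) \<le> xlog (card A + card B)"
proof -
  have fin: "finite A" "finite B" using A B finite_Q by (auto intro: finite_subset)
  define q where "q = card {x \<in> B. x \<in> A \<and> antipode n x \<in> A}"
  \<comment> \<open>A point of \<open>B\<close> has both a cross edge and a crossing antipode only
    if it and its antipode lie in \<open>A\<close>; \<open>q\<close> counts these.\<close>
  have "card (A \<inter> B) + card {x \<in> B. antipode n x \<in> A} =
      card (A \<inter> B \<union> {x \<in> B. antipode n x \<in> A}) + card (A \<inter> B \<inter> {x \<in> B. antipode n x \<in> A})"
    using fin by (intro card_Un_Int) auto
  moreover have "card (A \<inter> B \<union> {x \<in> B. antipode n x \<in> A}) \<le> card B"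
    using fin by (intro card_mono) auto
  moreover have "A \<inter> B \<inter> {x \<in> B. antipode n x \<in> A} = {x \<in> B. x \<in> A \<and> antipode n x \<in> A}"
    by auto
  ultimately have cross: "card (A \<inter> B) + card {x \<in> B. antipode n x \<in> A} \<le> card B + q"
    by (simp add: q_def)
  have q: "2 * q \<le> antipodal_count n A + antipodal_count n B"
    unfolding q_def by (rule card_antipodal_overlap_le [OF A B])
  have qB: "q \<le> card B"
    unfolding q_def using fin by (intro card_mono) auto
  have half_B: "inner_degree n B + antipodal_count n B \<le> xlog (card B)"
    using le sum by (intro IH B) linarith
  show ?thesis
  proof (cases "2 * card A \<le> 2 ^ n")
    case True
    then have "inner_degree n A + antipodal_count n A \<le> xlog (card A)"
      by (intro IH A)
    then show ?thesis
      using half_B cross q xlog_add_ge [of "card B" "card A"] le by simp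
  next
    case False
    define C where "C = Q n - A"
    have cardC: "card C + card A = 2 ^ n"
      using card_mono [OF finite_Q A] card_Q [of n]
      by (simp add: C_def card_Diff_subset [OF fin(1) A])
    have "real (card C + card A) = 2 ^ n" by (simp only: cardC) simp
    then have rC: "real (card A) = 2 ^ n - real (card C)" by simp
    have C: "C \<subseteq> Q n" "2 * card C \<le> 2 ^ n" "card B \<le> card C"
      using cardC False sum by (auto simp: C_def)
    have C2: "2 * real (card C) \<le> 2 ^ n"
      using C(2) by (metis of_nat_le_iff of_nat_mult of_nat_numeral of_nat_power)
    have "real (inner_degree n A) + n * real (card C) = inner_degree n C + n * real (card A)"
      using inner_degree_Diff [OF A] unfolding C_def by (metis of_nat_add of_nat_mult)
    then have dA: "real (inner_degree n A) = n * (2 ^ n - 2 * real (card C)) + inner_degree n C"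
      by (simp add: rC algebra_simps)
    have pA: "real (antipodal_count n A) = 2 ^ n - 2 * real (card C) + antipodal_count n C"
      using antipodal_count_Diff [OF A] rC unfolding C_def by linarith
    have harper: "inner_degree n C \<le> xlog (card C)" by (rule inner_degree_le [OF C(1)])
    have half_C: "inner_degree n C + antipodal_count n C \<le> xlog (card C)" by (rule IH [OF C(1,2)])
    \<comment> \<open>The first branch of the minimum comes from \<open>qB\<close> with
      \<open>harper\<close>, the second from \<open>q\<close> with \<open>pA\<close> and
      \<open>half_C\<close>.\<close>
    have "n * (2 ^ n - 2 * real (card C)) + xlog (card C) + xlog (card B) + 2 * real (card B)
        + min (2 * real (card B)) (2 ^ n - 2 * real (card C)) \<le> xlog (2 ^ n - real (card C) + card B)"
      using C C2 by (intro xlog_complement_ineq_scaled) auto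
    then show ?thesis
      using dA pA harper half_C half_B cross q qB rC by simp
  qed
qed

text \<open>
  The size restriction is essential: for \<open>A = Q n\<close> the left-hand side is \<open>2\<^sup>n (n + 1)\<close> and the
  right-hand side \<open>2\<^sup>n n\<close>.
\<close>

lemma isoperimetric_antipodal:
  assumes "n \<ge> 1" "A \<subseteq> Q n" "2 * card A \<le> 2 ^ n"
  shows "real (inner_degree n A + antipodal_count n A) \<le> xlog (card A)"
  using assms
proof (induction n arbitrary: A rule: nat_induct_at_least)
  case base
  have fin: "finite A" using base by (auto intro: finite_subset)
  have "card A = 0 \<or> card A = 1" using base by auto
  then consider "A = {}" | x where "A = {x}"
    using fin by (auto simp: card_1_singleton_iff)
  then show ?case
  proof cases
    case 1
    then show ?thesis by (simp add: inner_degree_def antipodal_count_def)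
  next
    case 2
    have x: "x \<in> Q 1" using base 2 by simp
    then have "x 1 \<noteq> 0" using Q_values [OF x, of 1] by auto
    then have "flip 1 x \<noteq> x" "antipode 1 x \<noteq> x"
      by (auto simp: flip_def antipode_def fun_eq_iff)
    then have empty: "{y \<in> A. flip (Suc 0) y \<in> A} = {}" "{y \<in> A. antipode (Suc 0) y \<in> A} = {}"
      using 2 by auto
    have "card A = 1" using 2 by simp
    then show ?thesis by (simp add: inner_degree_def antipodal_count_def empty)
  qed
next
  case (Suc n)
  define B C where "B = slice n 1 A" and "C = slice n (-1) A"
  have sub: "B \<subseteq> Q n" "C \<subseteq> Q n"
    unfolding B_def C_def by (rule slice_subset)+
  have card: "card A = card B + card C"
    unfolding B_def C_def by (rule card_slices [OF Suc.prems(1)])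
  have deg: "inner_degree (Suc n) A = inner_degree n B + inner_degree n C + 2 * card (B \<inter> C)"
    unfolding B_def C_def by (rule inner_degree_Suc [OF Suc.prems(1)])
  have anti: "antipodal_count (Suc n) A = 2 * card {x \<in> C. antipode n x \<in> B}"
    unfolding B_def C_def by (rule antipodal_count_Suc [OF Suc.prems(1)])
  \<comment> \<open>The step lemma counts antipodes from the smaller slice, which may be
    \<open>B\<close>.\<close>
  have swap: "card {x \<in> C. antipode n x \<in> B} = card {x \<in> B. antipode n x \<in> C}"
    by (rule card_antipode_swap [OF sub(2,1)])
  have sum: "card B + card C \<le> 2 ^ n" using Suc.prems(2) card by simp
  show ?case
  proof (cases "card C \<le> card B")
    case True
    then show ?thesis
      using isoperimetric_step [OF Suc.IH sub True sum] card deg anti by simp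
  next
    case False
    then have "card B \<le> card C" by simp
    then show ?thesis
      using isoperimetric_step [OF Suc.IH sub(2,1)] card deg anti swap sum
      by (simp add: Int_commute add.commute add.left_commute)
  qed
qed

subsection \<open>Cuts and \<open>\<ell>\<^sub>1\<close> embeddings\<close>

text \<open>Pairs are ordered, so each unordered pair counts twice; likewise each edge in
  \<open>edge_sum\<close>.\<close>

definition pair_sum :: "nat \<Rightarrow> ((nat \<Rightarrow> real) \<Rightarrow> real) \<Rightarrow> real" where
  "pair_sum n h = (\<Sum>u\<in>Q n. \<Sum>v\<in>Q n. \<bar>h u - h v\<bar>)"

definition edge_sum :: "nat \<Rightarrow> ((nat \<Rightarrow> real) \<Rightarrow> real) \<Rightarrow> real" where
  "edge_sum n h = (\<Sum>u\<in>Q n. \<Sum>i=1..n. \<bar>h u - h (flip i u)\<bar>)"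

definition star_sum :: "nat \<Rightarrow> ((nat \<Rightarrow> real) \<Rightarrow> real) \<Rightarrow> real \<Rightarrow> real" where
  "star_sum n h c = (\<Sum>u\<in>Q n. \<bar>h u - c\<bar>)"

text \<open>A threshold is weighted by its gap to the next smaller element of \<open>Y\<close>, so
  the thresholds between two points telescope to their distance.\<close>

lemma abs_diff_as_threshold_sum:
  fixes Y :: "real set"
  assumes "finite Y"
  shows "\<exists>T w. T \<subseteq> Y \<and> (\<forall>t\<in>T. 0 \<le> w t) \<and>
    (\<forall>x\<in>Y. \<forall>y\<in>Y. \<bar>x - y\<bar> = (\<Sum>t\<in>T. w t * \<bar>of_bool (t \<le> x) - of_bool (t \<le> y)\<bar>))"
  using assms
proof (induction Y rule: finite_linorder_max_induct)
  case empty
  then show ?case by auto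
next
  case (insert m Y)
  show ?case
  proof (cases "Y = {}")
    case True
    \<comment> \<open>A single point has no gap below it, hence no threshold.\<close>
    then show ?thesis by (intro exI [of _ "{}"]) auto
  next
    case False
    define M where "M = Max Y"
    have M: "M \<in> Y" "M < m" "\<And>y. y \<in> Y \<Longrightarrow> y \<le> M"
      using insert.hyps False by (auto simp: M_def)
    obtain T w where T: "T \<subseteq> Y" "\<And>t. t \<in> T \<Longrightarrow> 0 \<le> w t"
      and eq: "\<And>x y. x \<in> Y \<Longrightarrow> y \<in> Y \<Longrightarrow>
        \<bar>x - y\<bar> = (\<Sum>t\<in>T. w t * \<bar>of_bool (t \<le> x) - of_bool (t \<le> y)\<bar>)"
      using insert.IH by blast
    have finT: "finite T" and mT: "m \<notin> T"
      using T insert.hyps by (auto intro: finite_subset)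
    define w' where "w' = w(m := m - M)"
    define F where "F x y = (\<Sum>t\<in>insert m T. w' t * \<bar>of_bool (t \<le> x) - of_bool (t \<le> y)\<bar>)"
      for x y :: real
    have F: "F x y = (m - M) * \<bar>of_bool (m \<le> x) - of_bool (m \<le> y)\<bar>
        + (\<Sum>t\<in>T. w t * \<bar>of_bool (t \<le> x) - of_bool (t \<le> y)\<bar>)" for x y
      unfolding F_def using finT mT
      by (auto simp: w'_def intro!: sum.cong)
    have sym: "F x y = F y x" for x y
      by (simp add: F_def abs_minus_commute)
    have top: "\<bar>m - y\<bar> = F m y" if y: "y \<in> Y" for y
    proof -
      \<comment> \<open>Old thresholds are at most \<open>M\<close>, so they cannot tell
        \<open>m\<close> from \<open>M\<close>.\<close>
      have "(\<Sum>t\<in>T. w t * \<bar>of_bool (t \<le> m) - of_bool (t \<le> y)\<bar>) =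
          (\<Sum>t\<in>T. w t * \<bar>of_bool (t \<le> M) - of_bool (t \<le> y)\<bar>)"
        using T(1) M by (intro sum.cong refl) (force simp: subset_iff)
      then show ?thesis
        using M y insert.hyps(2) eq [OF M(1) y] by (fastforce simp: F)
    qed
    have "\<bar>x - y\<bar> = F x y" if xy: "x \<in> insert m Y" "y \<in> insert m Y" for x y
    proof -
      consider "x = m" "y = m" | "x = m" "y \<in> Y" | "x \<in> Y" "y = m" | "x \<in> Y" "y \<in> Y"
        using xy by blast
      then show ?thesis
      proof cases
        case 3
        then show ?thesis using top [of x] sym by (simp add: abs_minus_commute)
      next
        case 4
        then have "x < m" "y < m" using insert.hyps(2) by auto
        then show ?thesis using eq 4 by (simp add: F)
      qed (auto simp: top F)
    qed
    then show ?thesis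
      unfolding F_def using T M by (intro exI [of _ "insert m T"] exI [of _ w']) (auto simp: w'_def)
  qed
qed

text \<open>
  The weight \<open>ln 2\<close> makes the tangent bound \<open>ln (8 \<sigma>) \<le> 8 \<sigma> - 1\<close> give exactly the claim. The weights
  sum to \<open>7/4\<close>, with equality for the set of density \<open>1/8\<close> where four coordinates agree.
\<close>

lemma symmetric_cut_ineq:
  assumes n: "n \<ge> 1" and S: "S \<subseteq> Q n" and sym: "\<And>u. u \<in> S \<Longrightarrow> antipode n u \<in> S"
  shows "2 * real (card S) * (2 ^ n - real (card S)) \<le>
    ln 2 / 8 * 2 ^ n * (2 * (n * real (card S) - inner_degree n S)) + (7/4 - ln 2) * 2 ^ n * card S"
proof -
  define s where "s = real (card S)"
  define N :: real where "N = 2 ^ n"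
  have N: "N > 0" by (simp add: N_def)
  have s0: "s \<ge> 0" by (simp add: s_def)
  have fin: "finite S" using S finite_Q by (rule finite_subset)
  have "2 * s * (N - s) \<le> ln 2 / 8 * N * (2 * (n * s - inner_degree n S)) + (7/4 - ln 2) * N * s"
  proof (cases "2 * s \<le> N")
    case True
    show ?thesis
    proof (cases "s = 0")
      case True
      then have "S = {}" using fin by (simp add: s_def)
      then show ?thesis by (simp add: True inner_degree_def)
    next
      case False
      define \<sigma> where "\<sigma> = s / N"
      have \<sigma>: "\<sigma> > 0" "s = N * \<sigma>" using False s0 N by (simp_all add: \<sigma>_def)
      have "2 * card S \<le> 2 ^ n"
        using True unfolding s_def N_def
        by (metis of_nat_le_iff of_nat_mult of_nat_numeral of_nat_power)
      then have "real (inner_degree n S + antipodal_count n S) \<le> xlog s"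
        unfolding s_def by (rule isoperimetric_antipodal [OF n S])
      \<comment> \<open>Symmetry supplies the extra \<open>s\<close> beyond the classical
        bound.\<close>
      moreover have "antipodal_count n S = card S"
        unfolding antipodal_count_def by (rule arg_cong [where f = card]) (use sym in auto)
      ultimately have "inner_degree n S + s \<le> s * log 2 s"
        by (simp add: s_def xlog_def)
      also have "log 2 s = n + ln \<sigma> / ln 2"
        using \<sigma> N by (simp add: log_mult N_def) (simp add: log_def)
      finally have "s * (1 - ln \<sigma> / ln 2) \<le> n * s - inner_degree n S"
        by (simp add: algebra_simps)
      then have "ln 2 * (s * (1 - ln \<sigma> / ln 2)) \<le> ln 2 * (n * s - inner_degree n S)"
        by (intro mult_left_mono) auto
      moreover have "ln 2 * (s * (1 - ln \<sigma> / ln 2)) = s * (ln 2 - ln \<sigma>)"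
        by (simp add: field_simps)
      moreover have "ln (8 * \<sigma>) \<le> 8 * \<sigma> - 1"
        using \<sigma> by (intro ln_le_minus_one) simp
      moreover have "ln (8 * \<sigma>) = 3 * ln 2 + ln \<sigma>"
        using \<sigma> ln_realpow [of 2 3] by (simp add: ln_mult)
      ultimately have "s * (4 * ln 2 + 1 - 8 * \<sigma>) \<le> ln 2 * (n * s - inner_degree n S)"
        using mult_left_mono [of "4 * ln 2 + 1 - 8 * \<sigma>" "ln 2 - ln \<sigma>" s] s0 by linarith
      then have le: "N * (s * (4 * ln 2 + 1 - 8 * \<sigma>)) \<le> N * (ln 2 * (n * s - inner_degree n S))"
        using N by (intro mult_left_mono) auto
      have "N * (s * (4 * ln 2 + 1 - 8 * \<sigma>)) = N * s * (4 * ln 2 + 1) - 8 * s * (N * \<sigma>)"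
        by (simp add: algebra_simps)
      then have "N * s * (4 * ln 2 + 1) - 8 * s * s \<le> N * (ln 2 * (n * s - inner_degree n S))"
        using le by (simp only: \<sigma>(2) [symmetric])
      \<comment> \<open>A quarter of this bounds the edge term; \<open>ln 2\<close> cancels against
        the star term, and \<open>1/4 + 7/4 = 2\<close> leaves exactly
        \<open>2 * s * (N - s)\<close>.\<close>
      then show ?thesis by (simp add: algebra_simps)
    qed
  next
    case False
    \<comment> \<open>Above half the cube the star term alone suffices: its coefficient is at least
      1 times \<open>N\<close>, and the edge term is nonnegative.\<close>
    have "real (inner_degree n S) \<le> (\<Sum>i=1..n. s)"
      unfolding inner_degree_def s_def of_nat_sum using fin
      by (intro sum_mono) (auto intro: card_mono)
    then have "0 \<le> ln 2 / 8 * N * (2 * (n * s - inner_degree n S))"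
      using N by simp
    moreover have "s * (2 * (N - s)) \<le> s * ((7/4 - ln 2) * N)"
    proof (intro mult_left_mono s0)
      have "2 * (N - s) \<le> 1 * N" using False by simp
      also have "\<dots> \<le> (7/4 - ln 2) * N"
        using N ln2_le_25_over_36 by (intro mult_right_mono) auto
      finally show "2 * (N - s) \<le> (7/4 - ln 2) * N" .
    qed
    ultimately show ?thesis by (simp add: algebra_simps)
  qed
  then show ?thesis by (simp only: s_def N_def)
qed

lemma abs_diff_of_bool:
  "\<bar>of_bool P - of_bool R\<bar> =
    of_bool (P \<noteq> b) + of_bool (R \<noteq> b) - 2 * of_bool (P \<noteq> b) * (of_bool (R \<noteq> b) :: real)"
  by (cases P; cases R; cases b) auto

text \<open>\<open>b\<close> is the side of the cut holding the origin and \<open>S\<close> the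
  other side. The sums become the number of separated ordered pairs, twice the edge boundary of
  \<open>S\<close>, and \<open>card S\<close>.\<close>

lemma cut_ineq:
  fixes P :: "(nat \<Rightarrow> real) \<Rightarrow> bool"
  assumes n: "n \<ge> 1" and sym: "\<And>u. u \<in> Q n \<Longrightarrow> P (antipode n u) = P u"
  shows "pair_sum n (\<lambda>u. of_bool (P u)) \<le>
    ln 2 / 8 * 2 ^ n * edge_sum n (\<lambda>u. of_bool (P u))
      + (7/4 - ln 2) * 2 ^ n * star_sum n (\<lambda>u. of_bool (P u)) (of_bool b)"
proof -
  define S where "S = {u \<in> Q n. P u \<noteq> b}"
  define h :: "(nat \<Rightarrow> real) \<Rightarrow> real" where "h u = of_bool (P u \<noteq> b)" for u
  have diff: "\<bar>of_bool (P u) - of_bool (P v)\<bar> = h u + h v - 2 * h u * h v" for u v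
    unfolding h_def by (rule abs_diff_of_bool)
  have sum_h: "(\<Sum>u\<in>Q n. h u) = card S"
    by (simp add: h_def S_def sum_of_bool_eq Int_def)
  have "pair_sum n (\<lambda>u. of_bool (P u)) =
      (\<Sum>u\<in>Q n. 2 ^ n * h u + card S - 2 * h u * card S)"
    by (simp add: pair_sum_def diff sum.distrib sum_subtractf card_Q sum_h flip: sum_distrib_left)
  also have "\<dots> = 2 * real (card S) * (2 ^ n - real (card S))"
    by (simp add: sum.distrib sum_subtractf card_Q sum_h algebra_simps flip: sum_distrib_left sum_distrib_right)
  finally have pair: "pair_sum n (\<lambda>u. of_bool (P u)) = 2 * real (card S) * (2 ^ n - real (card S))" .
  have edge: "edge_sum n (\<lambda>u. of_bool (P u)) = 2 * (n * real (card S) - inner_degree n S)"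
  proof -
    have "(\<Sum>u\<in>Q n. \<bar>of_bool (P u) - of_bool (P (flip i u))\<bar> :: real) =
        2 * real (card S) - 2 * real (card {u \<in> S. flip i u \<in> S})" if i: "i \<in> {1..n}" for i
    proof -
      \<comment> \<open>The flip permutes the cube, so both endpoint terms contribute
        \<open>card S\<close>.\<close>
      have "(\<Sum>u\<in>Q n. h (flip i u)) = (\<Sum>u\<in>Q n. h u)"
        by (rule sum.reindex_bij_betw [OF bij_betw_flip [OF i]])
      moreover have "(\<Sum>u\<in>Q n. h u * h (flip i u)) = card {u \<in> S. flip i u \<in> S}"
      proof -
        have "{u \<in> S. flip i u \<in> S} = {u \<in> Q n. P u \<noteq> b \<and> P (flip i u) \<noteq> b}"
          using i by (auto simp: S_def flip_in_Q)
        moreover have "h u * h (flip i u) = of_bool (P u \<noteq> b \<and> P (flip i u) \<noteq> b)" for u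
          by (simp add: h_def)
        ultimately show ?thesis by (simp add: sum_of_bool_eq Int_def)
      qed
      ultimately show ?thesis
        by (simp add: diff sum.distrib sum_subtractf sum_h mult.assoc flip: sum_distrib_left)
    qed
    then have "(\<Sum>i=1..n. \<Sum>u\<in>Q n. \<bar>of_bool (P u) - of_bool (P (flip i u))\<bar> :: real) =
        (\<Sum>i=1..n. 2 * real (card S) - 2 * real (card {u \<in> S. flip i u \<in> S}))"
      by (rule sum.cong [OF refl])
    also have "\<dots> = 2 * (n * real (card S) - inner_degree n S)"
      by (simp add: inner_degree_def sum_subtractf right_diff_distrib sum_distrib_left)
    finally show ?thesis unfolding edge_sum_def by (subst sum.swap)
  qed
  have "star_sum n (\<lambda>u. of_bool (P u)) (of_bool b) = (\<Sum>u\<in>Q n. h u)"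
    unfolding star_sum_def h_def by (intro sum.cong refl) auto
  then have star: "star_sum n (\<lambda>u. of_bool (P u)) (of_bool b) = card S" by (simp add: sum_h)
  show ?thesis
    unfolding pair edge star
    using sym by (intro symmetric_cut_ineq n) (auto simp: S_def antipode_in_Q)
qed

text \<open>All three sums decompose over threshold cuts with the same nonnegative weights, and each
  cut inherits evenness from \<open>h\<close>.\<close>

lemma even_function_ineq:
  fixes h :: "(nat \<Rightarrow> real) \<Rightarrow> real"
  assumes n: "n \<ge> 1" and sym: "\<And>u. u \<in> Q n \<Longrightarrow> h (antipode n u) = h u"
  shows "pair_sum n h \<le> ln 2 / 8 * 2 ^ n * edge_sum n h + (7/4 - ln 2) * 2 ^ n * star_sum n h c"
proof -
  \<comment> \<open>Including \<open>c\<close> lets the same thresholds measure the distances in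
    \<open>star_sum\<close>.\<close>
  have "finite (insert c (h ` Q n))" by simp
  from abs_diff_as_threshold_sum [OF this] obtain T w
    where T: "\<And>t. t \<in> T \<Longrightarrow> 0 \<le> w t"
      and eq: "\<And>x y. x \<in> insert c (h ` Q n) \<Longrightarrow> y \<in> insert c (h ` Q n) \<Longrightarrow>
        \<bar>x - y\<bar> = (\<Sum>t\<in>T. w t * \<bar>of_bool (t \<le> x) - of_bool (t \<le> y)\<bar>)"
    by blast
  have pair: "pair_sum n h = (\<Sum>t\<in>T. w t * pair_sum n (\<lambda>u. of_bool (t \<le> h u)))"
  proof -
    have "pair_sum n h =
        (\<Sum>u\<in>Q n. \<Sum>v\<in>Q n. \<Sum>t\<in>T. w t * \<bar>of_bool (t \<le> h u) - of_bool (t \<le> h v)\<bar>)"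
      unfolding pair_sum_def by (intro sum.cong refl eq) auto
    also have "\<dots> = (\<Sum>u\<in>Q n. \<Sum>t\<in>T. \<Sum>v\<in>Q n. w t * \<bar>of_bool (t \<le> h u) - of_bool (t \<le> h v)\<bar>)"
      by (intro sum.cong refl sum.swap)
    also have "\<dots> = (\<Sum>t\<in>T. \<Sum>u\<in>Q n. \<Sum>v\<in>Q n. w t * \<bar>of_bool (t \<le> h u) - of_bool (t \<le> h v)\<bar>)"
      by (rule sum.swap)
    finally show ?thesis by (simp add: pair_sum_def sum_distrib_left)
  qed
  have edge: "edge_sum n h = (\<Sum>t\<in>T. w t * edge_sum n (\<lambda>u. of_bool (t \<le> h u)))"
  proof -
    have "edge_sum n h =
        (\<Sum>u\<in>Q n. \<Sum>i=1..n. \<Sum>t\<in>T. w t * \<bar>of_bool (t \<le> h u) - of_bool (t \<le> h (flip i u))\<bar>)"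
      unfolding edge_sum_def by (intro sum.cong refl eq) (auto simp: flip_in_Q)
    also have "\<dots> = (\<Sum>u\<in>Q n. \<Sum>t\<in>T. \<Sum>i=1..n. w t * \<bar>of_bool (t \<le> h u) - of_bool (t \<le> h (flip i u))\<bar>)"
      by (intro sum.cong refl sum.swap)
    also have "\<dots> = (\<Sum>t\<in>T. \<Sum>u\<in>Q n. \<Sum>i=1..n. w t * \<bar>of_bool (t \<le> h u) - of_bool (t \<le> h (flip i u))\<bar>)"
      by (rule sum.swap)
    finally show ?thesis by (simp add: edge_sum_def sum_distrib_left)
  qed
  have star: "star_sum n h c = (\<Sum>t\<in>T. w t * star_sum n (\<lambda>u. of_bool (t \<le> h u)) (of_bool (t \<le> c)))"
  proof -
    have "star_sum n h c =
        (\<Sum>u\<in>Q n. \<Sum>t\<in>T. w t * \<bar>of_bool (t \<le> h u) - of_bool (t \<le> c)\<bar>)"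
      unfolding star_sum_def by (intro sum.cong refl eq) auto
    also have "\<dots> = (\<Sum>t\<in>T. \<Sum>u\<in>Q n. w t * \<bar>of_bool (t \<le> h u) - of_bool (t \<le> c)\<bar>)"
      by (rule sum.swap)
    finally show ?thesis by (simp add: star_sum_def sum_distrib_left)
  qed
  have "pair_sum n h \<le> (\<Sum>t\<in>T. w t *
      (ln 2 / 8 * 2 ^ n * edge_sum n (\<lambda>u. of_bool (t \<le> h u)) +
       (7/4 - ln 2) * 2 ^ n * star_sum n (\<lambda>u. of_bool (t \<le> h u)) (of_bool (t \<le> c))))"
    unfolding pair using T sym by (intro sum_mono mult_left_mono cut_ineq n) auto
  also have "\<dots> = ln 2 / 8 * 2 ^ n * edge_sum n h + (7/4 - ln 2) * 2 ^ n * star_sum n h c"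
    unfolding edge star sum_distrib_left sum.distrib [symmetric]
    by (intro sum.cong refl) (simp only: distrib_left mult_ac)
  finally show ?thesis .
qed

section \<open>Squared distances in \<open>V n\<close> and their averages over the cube\<close>

lemma sqdist_sum: "sqdist n x y = (\<Sum>p\<in>{1..n} \<times> {1..n}. (x p - y p)\<^sup>2)"
  by (simp add: sqdist_def L2_set_def sum_nonneg)

lemma Q_square: "u \<in> Q n \<Longrightarrow> i \<in> {1..n} \<Longrightarrow> u i * u i = 1"
  using Q_values [of u n i] by auto

text \<open>Both tensors have squared norm \<open>n\<^sup>2\<close>, and their inner product is the
  square of that of \<open>u\<close> and \<open>v\<close>.\<close>

lemma sqdist_tensor:
  assumes "u \<in> Q n" "v \<in> Q n"
  shows "sqdist n (tensor n u u) (tensor n v v) = 2 * (real n)\<^sup>2 - 2 * (\<Sum>i=1..n. u i * v i)\<^sup>2"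
proof -
  have "sqdist n (tensor n u u) (tensor n v v) =
      (\<Sum>i=1..n. \<Sum>j=1..n. (u i * u j - v i * v j)\<^sup>2)"
    by (simp add: sqdist_sum tensor_def sum.cartesian_product) (auto intro!: sum.cong)
  also have "\<dots> = (\<Sum>i=1..n. \<Sum>j=1..n. 2 - 2 * ((u i * v i) * (u j * v j)))"
  proof (intro sum.cong refl)
    fix i j assume ij: "i \<in> {1..n}" "j \<in> {1..n}"
    have "(u i * u j - v i * v j)\<^sup>2 =
        (u i * u i) * (u j * u j) + (v i * v i) * (v j * v j) - 2 * ((u i * v i) * (u j * v j))"
      by (simp add: power2_eq_square algebra_simps)
    then show "(u i * u j - v i * v j)\<^sup>2 = 2 - 2 * ((u i * v i) * (u j * v j))"
      using assms ij by (simp add: Q_square)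
  qed
  also have "\<dots> = 2 * (real n)\<^sup>2 - 2 * (\<Sum>i=1..n. u i * v i)\<^sup>2"
    by (simp add: sum_subtractf power2_eq_square sum_product flip: sum_distrib_left)
  finally show ?thesis .
qed

lemma sqdist_tensor_zero:
  assumes "u \<in> Q n"
  shows "sqdist n (tensor n u u) (\<lambda>p\<in>{1..n} \<times> {1..n}. 0) = (real n)\<^sup>2"
proof -
  have "sqdist n (tensor n u u) (\<lambda>p\<in>{1..n} \<times> {1..n}. 0) = (\<Sum>p\<in>{1..n} \<times> {1..n}. 1)"
    unfolding sqdist_sum
  proof (rule sum.cong [OF refl], safe)
    fix i j assume ij: "i \<in> {1..n}" "j \<in> {1..n}"
    have "(u i * u j)\<^sup>2 = (u i * u i) * (u j * u j)" by (simp add: power2_eq_square)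
    then show "(tensor n u u (i, j) - (\<lambda>p\<in>{1..n} \<times> {1..n}. 0) (i, j))\<^sup>2 = 1"
      using assms ij by (simp add: tensor_def Q_square)
  qed
  then show ?thesis by (simp add: power2_eq_square)
qed

text \<open>One flip lowers the inner product with \<open>u\<close> from \<open>n\<close> to
  \<open>n - 2\<close>.\<close>

lemma sqdist_tensor_flip:
  assumes u: "u \<in> Q n" and i: "i \<in> {1..n}"
  shows "sqdist n (tensor n u u) (tensor n (flip i u) (flip i u)) = 8 * real n - 8"
proof -
  have "(\<Sum>j=1..n. u j * flip i u j) = (\<Sum>j=1..n. 1 - (if j = i then 2 else 0))"
    using Q_square [OF u] by (intro sum.cong refl) (simp add: flip_def)
  also have "\<dots> = real n - 2" using i by (simp add: sum_subtractf)
  finally have "sqdist n (tensor n u u) (tensor n (flip i u) (flip i u)) =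
      2 * (real n)\<^sup>2 - 2 * (real n - 2)\<^sup>2"
    using u i by (simp only: sqdist_tensor flip_in_Q)
  then show ?thesis by (simp add: power2_eq_square algebra_simps)
qed

text \<open>Coordinate functions are orthogonal: for \<open>i \<noteq> j\<close>, flipping
  coordinate \<open>i\<close> reverses the sign of the sum.\<close>

lemma sum_Q_coordinate_product:
  assumes "i \<in> {1..n}" "j \<in> {1..n}"
  shows "(\<Sum>v\<in>Q n. v i * v j) = (if i = j then 2 ^ n else 0)"
proof (cases "i = j")
  case True
  then have "(\<Sum>v\<in>Q n. v i * v j) = (\<Sum>v\<in>Q n. 1)"
    using assms by (intro sum.cong refl) (simp add: Q_square)
  then show ?thesis using True by (simp add: card_Q)
next
  case False
  have "(\<Sum>v\<in>Q n. v i * v j) = (\<Sum>v\<in>Q n. flip i v i * flip i v j)"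
    by (rule sum.reindex_bij_betw [OF bij_betw_flip, symmetric]) (rule assms)
  also have "\<dots> = - (\<Sum>v\<in>Q n. v i * v j)"
    using False by (simp add: flip_def sum_negf)
  finally show ?thesis using False by simp
qed

text \<open>By orthogonality, only the \<open>n\<close> diagonal terms of the expanded square
  survive.\<close>

lemma sum_Q_inner_square:
  assumes u: "u \<in> Q n"
  shows "(\<Sum>v\<in>Q n. (\<Sum>i=1..n. u i * v i)\<^sup>2) = n * 2 ^ n"
proof -
  have "(\<Sum>v\<in>Q n. (\<Sum>i=1..n. u i * v i)\<^sup>2) =
      (\<Sum>v\<in>Q n. \<Sum>i=1..n. \<Sum>j=1..n. (u i * u j) * (v i * v j))"
    by (simp add: power2_eq_square sum_product mult_ac)
  also have "\<dots> = (\<Sum>i=1..n. \<Sum>v\<in>Q n. \<Sum>j=1..n. (u i * u j) * (v i * v j))"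
    by (rule sum.swap)
  also have "\<dots> = (\<Sum>i=1..n. \<Sum>j=1..n. \<Sum>v\<in>Q n. (u i * u j) * (v i * v j))"
    by (intro sum.cong refl sum.swap)
  also have "\<dots> = (\<Sum>i=1..n. \<Sum>j=1..n. if j = i then 2 ^ n else 0)"
    using Q_square [OF u] sum_Q_coordinate_product [of _ n]
    by (intro sum.cong refl) (simp flip: sum_distrib_left)
  also have "\<dots> = n * 2 ^ n" by simp
  finally show ?thesis .
qed

text \<open>This makes every coordinate of a map on \<open>V n\<close> an even function of
  \<open>u\<close>.\<close>

lemma tensor_antipode: "tensor n (antipode n u) (antipode n u) = tensor n u u"
  unfolding tensor_def by (rule restrict_ext) (auto simp: antipode_def)

text \<open>\<open>even_function_ineq\<close> is summed over the coordinates of the embedding, with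
  \<open>c\<close> the coordinate of the image of the origin. Pairs are bounded by the lower
  embedding estimate, edges and distances to the origin by the upper one.\<close>

lemma l1_distortion_V_lower_bound:
  assumes n: "n \<ge> 1" and D: "D \<in> l1_distortions (V n) (sqdist n)"
  shows "8 / 7 - 8 / 7 / n \<le> D"
proof -
  define X where "X u = tensor n u u" for u
  define zero where "zero = (\<lambda>p\<in>{1..n} \<times> {1..n}. 0 :: real)"
  define N :: real where "N = 2 ^ n"
  have N: "N > 0" by (simp add: N_def)
  have V: "X u \<in> V n" "zero \<in> V n" if "u \<in> Q n" for u
    using that by (auto simp: V_def X_def zero_def)
  from D obtain M \<phi> \<gamma> where \<gamma>: "\<gamma> > 0" and D1: "D \<ge> 1"
    and lower: "\<And>a b. a \<in> V n \<Longrightarrow> b \<in> V n \<Longrightarrow> \<gamma> * sqdist n a b \<le> l1_dist M (\<phi> a) (\<phi> b)"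
    and upper: "\<And>a b. a \<in> V n \<Longrightarrow> b \<in> V n \<Longrightarrow> l1_dist M (\<phi> a) (\<phi> b) \<le> \<gamma> * D * sqdist n a b"
    unfolding l1_distortions_def by blast
  define h where "h m u = \<phi> (X u) m" for m u
  have "(\<Sum>m<M. pair_sum n (h m)) \<le>
      (\<Sum>m<M. ln 2 / 8 * N * edge_sum n (h m) + (7/4 - ln 2) * N * star_sum n (h m) (\<phi> zero m))"
    unfolding N_def
    by (intro sum_mono even_function_ineq n) (simp add: h_def X_def tensor_antipode)
  then have main: "(\<Sum>m<M. pair_sum n (h m)) \<le> ln 2 / 8 * N * (\<Sum>m<M. edge_sum n (h m))
      + (7/4 - ln 2) * N * (\<Sum>m<M. star_sum n (h m) (\<phi> zero m))"
    by (simp add: sum.distrib sum_distrib_left)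
  have "\<gamma> * (N * N * (2 * (real n)\<^sup>2 - 2 * n)) = (\<Sum>u\<in>Q n. \<Sum>v\<in>Q n. \<gamma> * sqdist n (X u) (X v))"
  proof -
    have "(\<Sum>v\<in>Q n. \<gamma> * sqdist n (X u) (X v)) = \<gamma> * (N * (2 * (real n)\<^sup>2 - 2 * n))"
      if u: "u \<in> Q n" for u
    proof -
      have "(\<Sum>v\<in>Q n. sqdist n (X u) (X v)) =
          (\<Sum>v\<in>Q n. 2 * (real n)\<^sup>2 - 2 * (\<Sum>i=1..n. u i * v i)\<^sup>2)"
        unfolding X_def by (intro sum.cong refl sqdist_tensor u)
      also have "\<dots> = N * (2 * (real n)\<^sup>2 - 2 * n)"
        using sum_Q_inner_square [OF u]
        by (simp add: sum_subtractf card_Q N_def algebra_simps flip: sum_distrib_left)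
      finally show ?thesis by (simp flip: sum_distrib_left)
    qed
    then show ?thesis by (simp add: card_Q N_def)
  qed
  also have "\<dots> \<le> (\<Sum>u\<in>Q n. \<Sum>v\<in>Q n. l1_dist M (\<phi> (X u)) (\<phi> (X v)))"
    by (intro sum_mono lower V)
  also have "\<dots> = (\<Sum>m<M. pair_sum n (h m))"
    unfolding l1_dist_def pair_sum_def h_def
    by (simp only: sum.swap [of _ _ "{..<M}"])
  also note main
  also have "(\<Sum>m<M. edge_sum n (h m)) \<le> \<gamma> * D * (N * n * (8 * real n - 8))"
  proof -
    have "(\<Sum>m<M. edge_sum n (h m)) = (\<Sum>u\<in>Q n. \<Sum>i=1..n. l1_dist M (\<phi> (X u)) (\<phi> (X (flip i u))))"
      unfolding l1_dist_def edge_sum_def h_def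
      by (simp only: sum.swap [of _ _ "{..<M}"])
    also have "\<dots> \<le> (\<Sum>u\<in>Q n. \<Sum>i=1..n. \<gamma> * D * sqdist n (X u) (X (flip i u)))"
      by (intro sum_mono upper V flip_in_Q)
    also have "\<dots> = (\<Sum>u\<in>Q n. \<Sum>i=1..n. \<gamma> * D * (8 * real n - 8))"
      unfolding X_def by (intro sum.cong refl) (simp add: sqdist_tensor_flip)
    also have "\<dots> = \<gamma> * D * (N * n * (8 * real n - 8))"
      by (simp add: card_Q N_def)
    finally show ?thesis .
  qed
  also have "(\<Sum>m<M. star_sum n (h m) (\<phi> zero m)) \<le> \<gamma> * D * (N * (real n)\<^sup>2)"
  proof -
    have "(\<Sum>m<M. star_sum n (h m) (\<phi> zero m)) = (\<Sum>u\<in>Q n. l1_dist M (\<phi> (X u)) (\<phi> zero))"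
      unfolding l1_dist_def star_sum_def h_def by (rule sum.swap)
    also have "\<dots> \<le> (\<Sum>u\<in>Q n. \<gamma> * D * sqdist n (X u) zero)"
      by (intro sum_mono upper V)
    also have "\<dots> = (\<Sum>u\<in>Q n. \<gamma> * D * (real n)\<^sup>2)"
      unfolding X_def zero_def by (intro sum.cong refl) (simp only: sqdist_tensor_zero)
    also have "\<dots> = \<gamma> * D * (N * (real n)\<^sup>2)"
      by (simp add: card_Q N_def)
    finally show ?thesis .
  qed
  \<comment> \<open>The bound on \<open>ln 2\<close> keeps the star coefficient nonnegative, so both
    upper estimates can be substituted.\<close>
  finally have "\<gamma> * (N * N * (2 * (real n)\<^sup>2 - 2 * n)) \<le>
      ln 2 / 8 * N * (\<gamma> * D * (N * n * (8 * real n - 8))) + (7/4 - ln 2) * N * (\<gamma> * D * (N * (real n)\<^sup>2))"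
    using N ln2_le_25_over_36 by simp
  also have "\<dots> = \<gamma> * (N * N * (D * (7/4 * (real n)\<^sup>2 - ln 2 * n)))"
    by (simp add: power2_eq_square field_simps)
  finally have "2 * (real n)\<^sup>2 - 2 * n \<le> D * (7/4 * (real n)\<^sup>2 - ln 2 * n)"
    using \<gamma> N by simp
  \<comment> \<open>The quadratic \<open>ln 2\<close> terms have cancelled; discarding the one
    linear in \<open>n\<close> keeps the limit 8/7.\<close>
  also have "\<dots> \<le> D * (7/4 * (real n)\<^sup>2)"
    using D1 by (intro mult_left_mono) auto
  finally have "real n * (8 * real n - 8) \<le> real n * (7 * D * real n)"
    by (simp add: power2_eq_square algebra_simps)
  then have "8 * real n - 8 \<le> 7 * D * real n"
    using n by (elim mult_left_le_imp_le) simp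
  then show ?thesis
    using n by (simp add: field_simps)
qed

theorem theorem6:
  shows "\<forall>\<epsilon>::real. \<epsilon> > 0 \<longrightarrow>
    (\<exists>n0::nat. n0 \<ge> 1 \<and> (\<forall>n\<ge>n0. c1 (V n) (sqdist n) \<ge> 8 / 7 - \<epsilon>))"
proof (intro allI impI)
  fix \<epsilon> :: real assume \<epsilon>: "\<epsilon> > 0"
  \<comment> \<open>From this \<open>n0\<close> on, the loss \<open>8 / 7 / n\<close> is at most
    \<open>\<epsilon>\<close>.\<close>
  obtain n0 :: nat where n0: "8 / 7 / \<epsilon> < n0" using reals_Archimedean2 by blast
  have "c1 (V n) (sqdist n) \<ge> 8 / 7 - \<epsilon>" if n: "n \<ge> max 1 n0" for n
    unfolding c1_def
  proof (rule cInf_greatest [OF l1_distortions_V_nonempty])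
    fix D assume "D \<in> l1_distortions (V n) (sqdist n)"
    then have "8 / 7 - 8 / 7 / n \<le> D" using n by (intro l1_distortion_V_lower_bound) auto
    moreover have "8 / 7 / n \<le> \<epsilon>"
    proof -
      have "8 / 7 / \<epsilon> < n" using n0 n by simp
      then show ?thesis using \<epsilon> n by (simp add: field_simps)
    qed
    ultimately show "8 / 7 - \<epsilon> \<le> D" by simp
  qed
  then show "\<exists>n0::nat. n0 \<ge> 1 \<and> (\<forall>n\<ge>n0. c1 (V n) (sqdist n) \<ge> 8 / 7 - \<epsilon>)"
    by (intro exI [of _ "max 1 n0"]) auto
qed

end
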